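(* Let $F(t)=\sum_{k\ge 0}c_kt^k$ (a power series that converges for all $|t|\le 1$). Then for any $0\le t<1$, $$\int_0^1\frac{F(tx^2)}{1-tx}\,dx=1.$$
   Context: Let $\mathcal H=L^2([0,1],dx)$ (complex-valued functions, Lebesgue measure) with its norm $\|\cdot\|$. The sequence $(c_n)_{n\ge 0}$ is defined recursively: $c_0=1$, and, writing $p_n(x)=c_0+c_1x+\ldots+c_nx^n$, for each $n\ge 0$ the number $c_{n+1}$ is the unique complex number $c$ for which the norm $\|p_n(x)+c\,x^{n+1}\|$ is minimal among all $c\in\mathbb C$. Equivalently, $c_0=1$ and $\frac{c_0}{n+1}+\frac{c_1}{n+2}+\ldots+\frac{c_n}{2n+1}=0$ for all $n\ge 1$. *)

theory Defs
  imports "HOL-Analysis.Analysis"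
begin

text \<open>The norm of \<open>L\<^sup>2([0,1], dx)\<close>. It is only applied to polynomial functions, so no
  quotient by null functions and no integrability side condition is needed.\<close>

definition L2_norm :: "(real \<Rightarrow> complex) \<Rightarrow> real" where
  "L2_norm f = sqrt (LINT x:{0..1}|lborel. (cmod (f x))\<^sup>2)"

text \<open>The description operator \<open>THE\<close> is well defined here: the minimizer is the (unique)
  coefficient of the orthogonal projection of \<open>- p\<^sub>n\<close> to the line spanned by \<open>x ^ Suc n\<close>.\<close>

fun greedy_coeff :: "nat \<Rightarrow> complex" where
  "greedy_coeff 0 = 1"
| "greedy_coeff (Suc n) =
     (THE c. is_arg_min
        (\<lambda>c. L2_norm (\<lambda>x. (\<Sum>k\<le>n. greedy_coeff k * of_real x ^ k) + c * of_real x ^ Suc n))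
        (\<lambda>_. True) c)"

definition greedy_series :: "complex \<Rightarrow> complex" where
  "greedy_series t = (\<Sum>k. greedy_coeff k * t ^ k)"

end

(* Expanding F(t x^2) / (1 - t x) as a Cauchy product and integrating termwise, the coefficient of
   t^n is the sum of c_k / (n + k + 1) over k <= n, which is 1 for n = 0 and, by orthogonality of
   p_n to x^n, 0 for n >= 1.

   The convergence on the closed disc follows from absolute summability of c. Let S_n be the partial
   sums of c. Summation by parts turns the relations into
     G_n = S_n / (2n+1) + (sum over k < n of S_k / ((n+k+1)(n+k+2))) = 0.
   These only say that S_n is an average of the values -S_k, with total weight tending to 1, so they
   give boundedness but no decay. In (n+2) G_n - n G_(n-1) = 0, however, the coefficients of S_k for
   k < n - 1 are 2k / ((n+k)(n+k+1)(n+k+2)), small enough that a weighted sum V_n of |S_0|, ..., |S_n|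
   drops by at least |S_n| / (2n+1) in each step. Since (2n+1) G_n - (2n-1) G_(n-1) = 0
   expresses c_n through S_0, ..., S_(n-1) with coefficients of order 1/n^2 (1/n for S_(n-1)), the
   sum of |c_n| is bounded by such a potential as well. *)

theory Submission
  imports Defs
begin

section \<open>Absolute summability from the Hilbert-type relations\<close>

lemma sum_scaleR_by_parts:
  fixes c :: "nat \<Rightarrow> 'a::real_vector"
  shows "(\<Sum>k\<le>n. w k *\<^sub>R c k) =
    w n *\<^sub>R (\<Sum>k\<le>n. c k) + (\<Sum>k<n. (w k - w (Suc k)) *\<^sub>R (\<Sum>j\<le>k. c j))"
  by (induction n) (simp_all add: algebra_simps)

text \<open>Supplies both the convergence on the closed disc, boundary included, and the majorant
  for termwise integration.\<close>

lemma summable_norm_of_hilbert_relations: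
  fixes c :: "nat \<Rightarrow> 'a::real_normed_vector"
  assumes rel: "\<And>n. n \<ge> 1 \<Longrightarrow> (\<Sum>k\<le>n. (1 / real (n + k + 1)) *\<^sub>R c k) = 0"
  shows "summable (\<lambda>n. norm (c n))"
proof -
  define S where "S n = (\<Sum>k\<le>n. c k)" for n
  define s where "s n = norm (S n)" for n
  \<comment> \<open>The difference of the consecutive weights \<open>1 / (n + k + 1)\<close> and
    \<open>1 / (n + k + 2)\<close>, which summation by parts puts in front of
    \<open>S k\<close>.\<close>
  define u where "u n k = 1 / ((real n + real k + 1) * (real n + real k + 2))" for n k
  have s_nonneg: "s n \<ge> 0" for n
    by (simp add: s_def)
  have rel_S: "(1 / (2 * real n + 1)) *\<^sub>R S n + (\<Sum>k<n. u n k *\<^sub>R S k) = 0" if "n \<ge> 1" for n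
  proof -
    have "1 / real (n + k + 1) - 1 / real (n + Suc k + 1) = u n k" for k
      unfolding u_def by (simp add: divide_simps) (simp add: algebra_simps)
    then show ?thesis
      using rel[OF that] sum_scaleR_by_parts[of "\<lambda>k. 1 / real (n + k + 1)" c n]
      by (simp add: S_def add.commute)
  qed
  have u_diag: "u (Suc m) m = 1 / ((2 * real m + 2) * (2 * real m + 3))" for m
    by (simp add: u_def algebra_simps)
  \<comment> \<open>The relations \<open>rel_S\<close> at \<open>Suc m\<close> and at
    \<open>m\<close> both have value 0, so \<open>a\<close> times the first equals \<open>b\<close>
    times the second; this is solved for \<open>S (Suc m)\<close>. The factors stay free because two
    different choices follow.\<close>
  have combine: "(a / (2 * real m + 3) ) *\<^sub>R S (Suc m) =
      (b / (2 * real m + 1) - a / ((2 * real m + 2) * (2 * real m + 3))) *\<^sub>R S m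
      + (\<Sum>k<m. (b * u m k - a * u (Suc m) k) *\<^sub>R S k)" if "m \<ge> 1" for a b m
  proof -
    have "a *\<^sub>R ((1 / (2 * real (Suc m) + 1)) *\<^sub>R S (Suc m) + (\<Sum>k<Suc m. u (Suc m) k *\<^sub>R S k))
        = b *\<^sub>R ((1 / (2 * real m + 1)) *\<^sub>R S m + (\<Sum>k<m. u m k *\<^sub>R S k))"
      using rel_S[of m] rel_S[of "Suc m"] that by simp
    moreover have "2 * real (Suc m) + 1 = 2 * real m + 3"
      by simp
    ultimately show ?thesis
      by (simp add: u_diag scaleR_right_distrib scaleR_left_diff_distrib scaleR_sum_right sum_subtractf
          algebra_simps)
  qed
  \<comment> \<open>Equals \<open>u m k - u (Suc m) k\<close>, so sums of \<open>e m k\<close> over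
    \<open>m\<close> telescope.\<close>
  define e where "e m k = 2 / ((real m + real k + 1) * (real m + real k + 2) * (real m + real k + 3))" for m k
  have e_nonneg: "e m k \<ge> 0" for m k
    by (simp add: e_def)
  have decay: "(real m + 3) / (2 * real m + 3) * s (Suc m) \<le>
      ((real m + 1) / (2 * real m + 1) - (real m + 3) / ((2 * real m + 2) * (2 * real m + 3))) * s m
      + (\<Sum>k<m. real k * e m k * s k)" if "m \<ge> 1" for m
  proof -
    \<comment> \<open>With N = m + k, the numerator over (N+1)(N+2)(N+3) is (m+1)(N+3) - (m+3)(N+1)
      = -2k. The factors m+1 and m+3 are chosen so that the terms in m cancel.\<close>
    have coeff: "(real m + 1) * u m k - (real m + 3) * u (Suc m) k = - (real k * e m k)" for k
    proof -
      have "real m + real k + 1 > 0" "real m + real k + 2 > 0" "real m + real k + 3 > 0"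
        by simp_all
      then show ?thesis
        unfolding u_def e_def by (simp add: divide_simps) (simp add: algebra_simps)
    qed
    have nonneg: "(real m + 1) / (2 * real m + 1) - (real m + 3) / ((2 * real m + 2) * (2 * real m + 3)) \<ge> 0"
    proof -
      have "(real m + 3) / ((2 * real m + 2) * (2 * real m + 3)) \<le> 1 / 2"
        by (simp add: divide_simps) (simp add: algebra_simps)
      moreover have "1 / 2 \<le> (real m + 1) / (2 * real m + 1)"
        by (simp add: divide_simps)
      ultimately show ?thesis by linarith
    qed
    have "(real m + 3) / (2 * real m + 3) * s (Suc m) = norm (((real m + 3) / (2 * real m + 3)) *\<^sub>R S (Suc m))"
      by (simp add: s_def)
    also have "\<dots> = norm (((real m + 1) / (2 * real m + 1) - (real m + 3) / ((2 * real m + 2) * (2 * real m + 3))) *\<^sub>R S m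
       + (\<Sum>k<m. (- (real k * e m k)) *\<^sub>R S k))"
      by (subst combine[OF that, where b = "real m + 1"]) (simp only: coeff)
    also have "\<dots> \<le> ((real m + 1) / (2 * real m + 1) - (real m + 3) / ((2 * real m + 2) * (2 * real m + 3))) * s m
       + (\<Sum>k<m. real k * e m k * s k)"
      by (intro norm_triangle_mono order.trans[OF norm_sum] sum_mono)
        (use nonneg e_nonneg in \<open>simp_all add: s_def abs_mult\<close>)
    finally show ?thesis .
  qed
  have increment: "norm (c (Suc m)) \<le> s m / (2 * real m + 2)
      + (\<Sum>k<m. 2 / ((real m + real k + 2) * (real m + real k + 3)) * s k)" if "m \<ge> 1" for m
  proof -
    \<comment> \<open>The factors 2m+3 and 2m+1 make the coefficient of \<open>S (Suc m)\<close>
      equal to 1 and that of \<open>S m\<close> equal to 1 - 1/(2m+2), so subtracting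
      \<open>S m\<close> leaves only a small multiple of it.\<close>
    have coeff: "(2 * real m + 1) * u m k - (2 * real m + 3) * u (Suc m) k = (real m - real k) * e m k" for k
    proof -
      have "real m + real k + 1 > 0" "real m + real k + 2 > 0" "real m + real k + 3 > 0"
        by simp_all
      then show ?thesis
        unfolding u_def e_def by (simp add: divide_simps) (simp add: algebra_simps)
    qed
    \<comment> \<open>Enlarging m - k to m + k + 1 cancels one factor of the denominator. What
      remains is the difference of 2/(m+k+2) and 2/(m+k+3), the form in which it telescopes in
      \<open>T\<close> below.\<close>
    have bound: "(real m - real k) * e m k \<le> 2 / ((real m + real k + 2) * (real m + real k + 3))" for k
    proof -
      have "(real m - real k) * e m k \<le> (real m + real k + 1) * e m k"
        by (intro mult_right_mono e_nonneg) simp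
      also have "\<dots> = 2 / ((real m + real k + 2) * (real m + real k + 3))"
      proof -
        have "real m + real k + 1 > 0"
          by simp
        then show ?thesis
          unfolding e_def by (simp add: divide_simps)
      qed
      finally show ?thesis .
    qed
    have "S (Suc m) = (1 - 1 / (2 * real m + 2)) *\<^sub>R S m + (\<Sum>k<m. ((real m - real k) * e m k) *\<^sub>R S k)"
      using combine[OF that, where a = "2 * real m + 3" and b = "2 * real m + 1"]
      by (simp add: coeff)
    then have "c (Suc m) = (- (1 / (2 * real m + 2))) *\<^sub>R S m + (\<Sum>k<m. ((real m - real k) * e m k) *\<^sub>R S k)"
      by (simp add: S_def algebra_simps)
    also have "norm \<dots> \<le> s m / (2 * real m + 2)
      + (\<Sum>k<m. 2 / ((real m + real k + 2) * (real m + real k + 3)) * s k)"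
    proof (intro norm_triangle_mono order.trans[OF norm_sum] sum_mono)
      show "norm ((- (1 / (2 * real m + 2))) *\<^sub>R S m) \<le> s m / (2 * real m + 2)"
        by (simp add: s_def)
      fix k assume "k \<in> {..<m}"
      then show "norm (((real m - real k) * e m k) *\<^sub>R S k)
          \<le> 2 / ((real m + real k + 2) * (real m + real k + 3)) * s k"
        using mult_right_mono[OF bound s_nonneg, of k k] e_nonneg[of m k]
        by (simp add: s_def abs_mult)
    qed
    finally show ?thesis .
  qed
  \<comment> \<open>The leading weight at \<open>Suc m\<close> is the left-hand coefficient in
    \<open>decay\<close>. The tail weight \<open>real k * u m k\<close> is the sum of
    \<open>real k * e i k\<close> over all i \<ge> m, so it pays in advance for every later
    occurrence of \<open>s k\<close> in \<open>decay\<close>.\<close>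
  define V where "V m = (real m + 2) / (2 * real m + 1) * s m + (\<Sum>k<m. real k * u m k * s k)" for m
  \<comment> \<open>The same device for \<open>increment\<close>: 2/(m+k+2) is the sum of
    2/((i+k+2)(i+k+3)) over all i \<ge> m.\<close>
  define T where "T m = (\<Sum>k<m. 2 / (real m + real k + 2) * s k)" for m
  have V_step: "V (Suc m) \<le> V m - s m / (2 * real m + 1)" if "m \<ge> 1" for m
  proof -
    have tail: "real k * u (Suc m) k = real k * u m k - real k * e m k" for k
    proof -
      have "real m + real k + 1 > 0" "real m + real k + 2 > 0" "real m + real k + 3 > 0"
        by simp_all
      then show ?thesis
        unfolding u_def e_def by (simp add: divide_simps) (simp add: algebra_simps)
    qed
    have "V (Suc m) = (real m + 3) / (2 * real m + 3) * s (Suc m)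
        + ((\<Sum>k<m. real k * u m k * s k) - (\<Sum>k<m. real k * e m k * s k) + real m * u (Suc m) m * s m)"
      by (simp add: V_def tail left_diff_distrib sum_subtractf add.commute)
    also have "\<dots> \<le> ((real m + 1) / (2 * real m + 1) - (real m + 3) / ((2 * real m + 2) * (2 * real m + 3))
         + real m * u (Suc m) m) * s m + (\<Sum>k<m. real k * u m k * s k)"
      using decay[OF that] by (simp add: distrib_right)
    also have "\<dots> \<le> ((real m + 2) / (2 * real m + 1) - 1 / (2 * real m + 1)) * s m
        + (\<Sum>k<m. real k * u m k * s k)"
    proof -
      \<comment> \<open>The summand k = m that enters the tail of \<open>V\<close> is absorbed by
        the negative term of \<open>decay\<close>, which has the same denominator.\<close>
      have "real m * u (Suc m) m \<le> (real m + 3) / ((2 * real m + 2) * (2 * real m + 3))"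
        unfolding u_diag times_divide_eq_right mult_1_right by (intro divide_right_mono) simp_all
      then show ?thesis
        by (intro add_right_mono mult_right_mono s_nonneg) (simp add: diff_divide_distrib[symmetric] add.commute)
    qed
    also have "\<dots> = V m - s m / (2 * real m + 1)"
      by (simp add: V_def left_diff_distrib)
    finally show ?thesis .
  qed
  have T_step: "T (Suc m) = T m - (\<Sum>k<m. 2 / ((real m + real k + 2) * (real m + real k + 3)) * s k)
      + 2 / (2 * real m + 3) * s m" for m
  proof -
    have tail: "2 / (real (Suc m) + real k + 2) =
        2 / (real m + real k + 2) - 2 / ((real m + real k + 2) * (real m + real k + 3))" for k
      by (simp add: divide_simps) (simp add: algebra_simps)
    show ?thesis
      unfolding T_def tail lessThan_Suc
      by (simp add: left_diff_distrib sum_subtractf) (simp add: divide_simps, simp add: algebra_simps)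
  qed
  have step: "norm (c (Suc m)) \<le> (3 * V m + T m) - (3 * V (Suc m) + T (Suc m))" if "m \<ge> 1" for m
  proof -
    \<comment> \<open>The factor 3 in front of \<open>V\<close>: one share of
      \<open>s m / (2 * real m + 1)\<close> covers the \<open>s m\<close> term of
      \<open>increment\<close>, two cover the summand that enters \<open>T\<close>.\<close>
    have "1 / (2 * real m + 2) + 2 / (2 * real m + 3) \<le> 1 / (2 * real m + 1) + 2 / (2 * real m + 1)"
      by (intro add_mono divide_left_mono) simp_all
    from mult_right_mono[OF this s_nonneg[of m]]
    have "s m / (2 * real m + 2) + 2 / (2 * real m + 3) * s m \<le> 3 * (s m / (2 * real m + 1))"
      by (simp add: distrib_right)
    then show ?thesis
      using increment[OF that] V_step[OF that] T_step[of m] by linarith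
  qed
  have VT_nonneg: "3 * V m + T m \<ge> 0" for m
    unfolding V_def T_def u_def
    by (intro add_nonneg_nonneg mult_nonneg_nonneg sum_nonneg s_nonneg) simp_all
  \<comment> \<open>The telescoping sum starts at \<open>c 2\<close> because \<open>step\<close>
    compares two consecutive relations and these begin at index 1.\<close>
  have "(\<Sum>i<n. norm (c (i + 2))) \<le> (3 * V 1 + T 1) - (3 * V (Suc n) + T (Suc n))" for n
  proof (induction n)
    case (Suc n)
    then show ?case using step[of "Suc n"] by simp
  qed simp
  then have "(\<Sum>i<n. norm (c (i + 2))) \<le> 3 * V 1 + T 1" for n
    using VT_nonneg[of "Suc n"] by (smt (verit))
  then have "summable (\<lambda>i. norm (c (i + 2)))"
    by (intro summableI_nonneg_bounded) auto
  then show ?thesis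
    by (subst (asm) summable_iff_shift)
qed

section \<open>Integrals of powers and orthogonality of the minimizers\<close>

lemma set_integral_power_Icc:
  "set_integrable lborel {0..1} (\<lambda>x::real. complex_of_real x ^ n)"
  "(LINT x:{0..1}|lborel. complex_of_real x ^ n) = 1 / of_nat (n + 1)"
proof -
  show "set_integrable lborel {0..1} (\<lambda>x::real. complex_of_real x ^ n)"
    unfolding set_integrable_def
    by (intro borel_integrable_compact continuous_intros) auto
  have "(LINT x:{0..1}|lborel. x ^ n) = 1 / real (n + 1)"
    using integral_power[of 0 1 n]
    by (simp add: set_lebesgue_integral_def mult.commute)
  then have "(LINT x:{0..1}|lborel. complex_of_real (x ^ n)) = of_real (1 / real (n + 1))"
    by (simp only: set_integral_complex_of_real)
  then show "(LINT x:{0..1}|lborel. complex_of_real x ^ n) = 1 / of_nat (n + 1)"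
    by simp
qed

lemma set_integral_sum_powers_Icc:
  fixes a :: "'i \<Rightarrow> complex"
  assumes "finite K"
  shows "set_integrable lborel {0..1} (\<lambda>x::real. \<Sum>k\<in>K. a k * of_real x ^ e k)"
    "(LINT x:{0..1}|lborel. \<Sum>k\<in>K. a k * of_real x ^ e k) = (\<Sum>k\<in>K. a k / of_nat (e k + 1))"
proof -
  have int: "set_integrable lborel {0..1} (\<lambda>x::real. a k * of_real x ^ e k)" for k
    by (intro set_integrable_mult_right set_integral_power_Icc)
  then show "set_integrable lborel {0..1} (\<lambda>x::real. \<Sum>k\<in>K. a k * of_real x ^ e k)"
    by (simp add: set_integrable_def scaleR_sum_right)
  have "(LINT x:{0..1}|lborel. \<Sum>k\<in>K. a k * of_real x ^ e k) =
      (\<Sum>k\<in>K. LINT x:{0..1}|lborel. a k * of_real x ^ e k)"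
    using int unfolding set_integrable_def set_lebesgue_integral_def scaleR_sum_right
    by (intro Bochner_Integration.integral_sum)
  then show "(LINT x:{0..1}|lborel. \<Sum>k\<in>K. a k * of_real x ^ e k) = (\<Sum>k\<in>K. a k / of_nat (e k + 1))"
    by (simp only: set_integral_mult_right set_integral_power_Icc times_divide_eq_right mult_1_right)
qed

text \<open>Pythagoras: in the expanded square the cross term integrates to twice the real part of
  \<open>cnj d\<close> times the inner product of q and x^m, which is 0, and x^m has squared norm
  1/(2m+1).\<close>

lemma L2_norm_add_orthogonal:
  fixes q :: "real \<Rightarrow> complex"
  assumes q: "continuous_on {0..1} q"
    and orth: "(LINT x:{0..1}|lborel. q x * of_real x ^ m) = 0"
  shows "L2_norm (\<lambda>x. q x + d * of_real x ^ m) = sqrt ((L2_norm q)\<^sup>2 + (cmod d)\<^sup>2 / (2 * real m + 1))"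
proof -
  have int1: "set_integrable lborel {0..1} (\<lambda>x. (cmod (q x))\<^sup>2)"
    unfolding set_integrable_def by (intro borel_integrable_compact continuous_intros q) auto
  have int2: "set_integrable lborel {0..1} (\<lambda>x. q x * of_real x ^ m)"
    unfolding set_integrable_def by (intro borel_integrable_compact continuous_intros q) auto
  have int3: "set_integrable lborel {0..1} (\<lambda>x::real. x ^ (2 * m))"
    unfolding set_integrable_def by (intro borel_integrable_compact continuous_intros) auto
  have int4: "set_integrable lborel {0..1} (\<lambda>x. 2 * Re (cnj d * (q x * of_real x ^ m)))"
    unfolding set_integrable_def by (intro borel_integrable_compact continuous_intros q) auto
  have cross: "(LINT x:{0..1}|lborel. 2 * Re (cnj d * (q x * of_real x ^ m))) = 0"
  proof -
    have "(LINT x:{0..1}|lborel. Re (cnj d * (q x * of_real x ^ m))) =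
        Re (LINT x:{0..1}|lborel. cnj d * (q x * of_real x ^ m))"
      using set_integrable_mult_right[OF int2, of "cnj d"]
      unfolding set_integrable_def set_lebesgue_integral_def
      by (subst integral_Re[symmetric]) simp_all
    then have "(LINT x:{0..1}|lborel. Re (cnj d * (q x * of_real x ^ m))) = 0"
      by (simp only: set_integral_mult_right orth) simp
    then show ?thesis by (simp only: set_integral_mult_right)
  qed
  have pw: "(LINT x:{0..1}|lborel. x ^ (2 * m)) = 1 / (2 * real m + 1)"
    using integral_power[of 0 1 "2 * m"]
    by (simp add: set_lebesgue_integral_def mult.commute)
  have "(cmod (q x + d * of_real x ^ m))\<^sup>2 =
      (cmod (q x))\<^sup>2 + 2 * Re (cnj d * (q x * of_real x ^ m)) + (cmod d)\<^sup>2 * x ^ (2 * m)" for x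
  proof -
    have "(cmod (a + d * of_real y))\<^sup>2 = (cmod a)\<^sup>2 + 2 * Re (cnj d * (a * of_real y)) + (cmod d)\<^sup>2 * y\<^sup>2" for a y
      unfolding cmod_power2 by (simp add: power2_eq_square algebra_simps)
    from this[of "q x" "x ^ m"] show ?thesis
      by (simp add: power_mult[symmetric] mult.commute)
  qed
  then have "(LINT x:{0..1}|lborel. (cmod (q x + d * of_real x ^ m))\<^sup>2) =
      (LINT x:{0..1}|lborel. (cmod (q x))\<^sup>2) + (cmod d)\<^sup>2 / (2 * real m + 1)"
    using int1 int3 int4 cross pw by (simp add: set_integral_add)
  moreover have "(L2_norm q)\<^sup>2 = (LINT x:{0..1}|lborel. (cmod (q x))\<^sup>2)"
    unfolding L2_norm_def
    by (intro real_sqrt_pow2) (simp add: set_lebesgue_integral_def integral_nonneg)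
  ultimately show ?thesis
    by (simp add: L2_norm_def)
qed

text \<open>The description operator is evaluated by exhibiting the coefficient that makes the new
  polynomial orthogonal to x^n. By Pythagoras any other coefficient strictly increases the
  norm.\<close>

lemma greedy_coeff_orthogonal:
  assumes "n \<ge> 1"
  shows "(\<Sum>k\<le>n. greedy_coeff k / of_nat (n + k + 1)) = 0"
proof -
  obtain j where n: "n = Suc j"
    using assms by (cases n) auto
  define p where "p x = (\<Sum>k\<le>j. greedy_coeff k * complex_of_real x ^ k)" for x
  \<comment> \<open>The solution of the linear equation that the inner product of p + c x^n with x^n
    vanishes.\<close>
  define c where "c = - of_nat (2 * n + 1) * (\<Sum>k\<le>j. greedy_coeff k / of_nat (n + k + 1))"
  define q where "q x = p x + c * of_real x ^ n" for x
  have c: "c / of_nat (n + n + 1) = - (\<Sum>k\<le>j. greedy_coeff k / of_nat (n + k + 1))"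
    by (simp add: c_def mult_2 divide_simps del: of_nat_add of_nat_Suc)
  have q_cont: "continuous_on {0..1} q"
    unfolding q_def p_def by (intro continuous_intros)
  have "q x * of_real x ^ n =
      (\<Sum>k\<le>j. greedy_coeff k * of_real x ^ (n + k)) + c * of_real x ^ (n + n)" for x
    by (simp add: q_def p_def distrib_right distrib_left sum_distrib_left sum_distrib_right power_add mult_ac)
  then have "(LINT x:{0..1}|lborel. q x * of_real x ^ n) =
      (\<Sum>k\<le>j. greedy_coeff k / of_nat (n + k + 1)) + c / of_nat (n + n + 1)"
    by (simp add: set_integral_add set_integral_sum_powers_Icc set_integral_power_Icc
        set_integrable_mult_right del: of_nat_add of_nat_Suc)
  also have "\<dots> = 0"
    unfolding c by simp
  finally have orth: "(LINT x:{0..1}|lborel. q x * of_real x ^ n) = 0" .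
  \<comment> \<open>Recentred at the orthogonal candidate: p + b x^n = q + (b - c) x^n.\<close>
  have norm: "L2_norm (\<lambda>x. p x + b * of_real x ^ n) =
      sqrt ((L2_norm q)\<^sup>2 + (cmod (b - c))\<^sup>2 / (2 * real n + 1))" for b
    using L2_norm_add_orthogonal[OF q_cont orth, of "b - c"] by (simp add: q_def[abs_def] algebra_simps)
  have "greedy_coeff n = (THE b. is_arg_min (\<lambda>b. L2_norm (\<lambda>x. p x + b * of_real x ^ n)) (\<lambda>_. True) b)"
    by (simp add: n p_def)
  also have "\<dots> = c"
  proof (rule the_equality)
    show "is_arg_min (\<lambda>b. L2_norm (\<lambda>x. p x + b * of_real x ^ n)) (\<lambda>_. True) c"
      unfolding norm is_arg_min_linorder by (simp del: real_sqrt_abs)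
  next
    fix b assume "is_arg_min (\<lambda>b. L2_norm (\<lambda>x. p x + b * of_real x ^ n)) (\<lambda>_. True) b"
    then have "(cmod (b - c))\<^sup>2 / (2 * real n + 1) \<le> (cmod (c - c))\<^sup>2 / (2 * real n + 1)"
      unfolding norm is_arg_min_linorder real_sqrt_le_iff add_le_cancel_left by blast
    then show "b = c"
      by (simp add: divide_le_0_iff)
  qed
  finally show ?thesis
    using c by (simp add: n)
qed

lemma summable_norm_greedy_coeff: "summable (\<lambda>k. cmod (greedy_coeff k))"
  by (rule summable_norm_of_hilbert_relations)
    (use greedy_coeff_orthogonal in \<open>simp add: scaleR_conv_of_real\<close>)

section \<open>Termwise integration of the generating function\<close>

lemma greedy_series_integral:
  fixes t :: real
  assumes t: "0 \<le> t" "t < 1"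
  defines "f \<equiv> \<lambda>x::real. greedy_series (of_real (t * x\<^sup>2)) / of_real (1 - t * x)"
  shows "set_integrable lborel {0..1} f" "(LINT x:{0..1}|lborel. f x) = 1"
proof -
  \<comment> \<open>The n-th Cauchy product term: c_k (t x^2)^k (t x)^(n-k) = c_k t^n x^(n+k). The
    power of t no longer depends on k, which gives the geometric majorant \<open>C * t ^ n\<close>,
    uniform in x.\<close>
  define g where "g n x = (\<Sum>k\<le>n. greedy_coeff k * of_real t ^ n * complex_of_real x ^ (n + k))" for n x
  define C where "C = (\<Sum>k. cmod (greedy_coeff k))"
  have C: "(\<Sum>k\<le>n. cmod (greedy_coeff k)) \<le> C" for n
    unfolding C_def by (intro sum_le_suminf summable_norm_greedy_coeff) auto
  have g_bound: "cmod (g n x) \<le> C * t ^ n" if "x \<in> {0..1}" for n x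
  proof -
    have "cmod (g n x) \<le> (\<Sum>k\<le>n. cmod (greedy_coeff k) * t ^ n)"
      unfolding g_def
      by (intro sum_norm_le) (use that t in \<open>auto simp: norm_mult norm_power intro!: mult_left_le power_le_one\<close>)
    also have "\<dots> \<le> C * t ^ n"
      using C t by (simp add: sum_distrib_right[symmetric] mult_right_mono)
    finally show ?thesis .
  qed
  have C_summable: "summable (\<lambda>n. C * t ^ n)"
    using t by (intro summable_mult summable_geometric) auto
  have g_sums: "(\<lambda>n. g n x) sums f x" if x: "x \<in> {0..1}" for x
  proof -
    have tx: "0 \<le> t * x" "t * x < 1"
      using t x by (auto intro: le_less_trans[OF mult_left_le[of x t]])
    have tx2: "0 \<le> t * x\<^sup>2" "t * x\<^sup>2 \<le> 1"
      using t x by (auto intro!: mult_le_one power_le_one)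
    have 1: "summable (\<lambda>k. cmod (greedy_coeff k * of_real (t * x\<^sup>2) ^ k))"
      by (rule summable_comparison_test'[OF summable_norm_greedy_coeff, of 0])
        (use tx2 in \<open>auto simp: norm_mult norm_power abs_mult simp del: of_real_mult intro!: mult_left_le power_le_one\<close>)
    have 2: "summable (\<lambda>k. cmod (of_real (t * x) ^ k))"
      using tx by (auto simp: norm_power simp del: of_real_mult intro!: summable_geometric)
    have "(\<lambda>n. \<Sum>k\<le>n. (greedy_coeff k * of_real (t * x\<^sup>2) ^ k) * of_real (t * x) ^ (n - k)) sums
        ((\<Sum>k. greedy_coeff k * of_real (t * x\<^sup>2) ^ k) * (\<Sum>k. of_real (t * x) ^ k))"
      by (rule Cauchy_product_sums[OF 1 2])
    also have "(\<Sum>k. of_real (t * x) ^ k) = 1 / (1 - complex_of_real (t * x))"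
      using tx by (intro suminf_geometric) (simp del: of_real_mult)
    also have "(\<lambda>n. \<Sum>k\<le>n. (greedy_coeff k * of_real (t * x\<^sup>2) ^ k) * of_real (t * x) ^ (n - k)) = (\<lambda>n. g n x)"
    proof (intro ext, unfold g_def, intro sum.cong refl)
      fix n k :: nat assume "k \<in> {..n}"
      then obtain d where "n = k + d" by (auto simp: le_iff_add)
      then show "(greedy_coeff k * of_real (t * x\<^sup>2) ^ k) * of_real (t * x) ^ (n - k) =
          greedy_coeff k * of_real t ^ n * complex_of_real x ^ (n + k)"
        by (simp add: power_mult_distrib power_add mult_ac power2_eq_square)
    qed
    finally show ?thesis
      by (simp add: f_def greedy_series_def)
  qed
  \<comment> \<open>Extension by zero to the whole line, where the theorems on integrating series
    apply.\<close>
  define h where "h n x = indicator {0..1} x *\<^sub>R g n x" for n x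
  have g_int: "set_integrable lborel {0..1} (g n)" for n
    unfolding g_def by (intro set_integral_sum_powers_Icc) simp
  then have h_int: "integrable lborel (h n)" for n
    by (simp add: h_def[abs_def] set_integrable_def)
  have h_bound: "norm (h n x) \<le> C * t ^ n * indicator {0..1} x" for n x
    using g_bound[of x n] by (simp add: h_def indicator_def)
  have h_summable: "AE x in lborel. summable (\<lambda>n. norm (h n x))"
  proof (intro AE_I2 summable_comparison_test'[OF C_summable, of 0])
    \<comment> \<open>Outside the unit interval \<open>h n x\<close> is 0, and
      \<open>g_bound\<close> at the point 0 shows that the majorant is nonnegative.\<close>
    fix n x show "norm (norm (h n x)) \<le> C * t ^ n"
      using h_bound[of n x] order.trans[OF norm_ge_zero g_bound[of 0 n]]
      by (cases "x \<in> {0..1}") auto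
  qed
  have norm_summable: "summable (\<lambda>n. \<integral>x. norm (h n x) \<partial>lborel)"
  proof (rule summable_comparison_test'[OF C_summable, of 0])
    fix n
    have "(\<integral>x. norm (h n x) \<partial>lborel) \<le> (\<integral>x. C * t ^ n * indicator {0..1::real} x \<partial>lborel)"
      by (intro integral_mono h_bound integrable_norm h_int) auto
    then show "norm (\<integral>x. norm (h n x) \<partial>lborel) \<le> C * t ^ n"
      by simp
  qed
  have h_suminf: "(\<Sum>n. h n x) = indicator {0..1} x *\<^sub>R f x" for x
    using g_sums[of x] by (auto simp: h_def indicator_def sums_iff)
  show "set_integrable lborel {0..1} f"
    using integrable_suminf[OF h_int h_summable norm_summable]
    by (simp add: h_suminf set_integrable_def)
  \<comment> \<open>Orthogonality removes every term except n = 0, whose value is c_0 = 1.\<close>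
  have "(LINT x|lborel. h n x) = (if n = 0 then 1 else 0)" for n
  proof -
    have "(LINT x|lborel. h n x) = (\<Sum>k\<le>n. greedy_coeff k * of_real t ^ n / of_nat (n + k + 1))"
      unfolding h_def set_lebesgue_integral_def[symmetric] g_def
      by (intro set_integral_sum_powers_Icc) simp
    also have "\<dots> = of_real t ^ n * (\<Sum>k\<le>n. greedy_coeff k / of_nat (n + k + 1))"
      by (simp add: sum_distrib_left mult_ac)
    also have "\<dots> = (if n = 0 then 1 else 0)"
      using greedy_coeff_orthogonal[of n] by (cases "n = 0") auto
    finally show ?thesis .
  qed
  then have "(\<lambda>n. if n = 0 then 1 else 0) sums (LINT x:{0..1}|lborel. f x)"
    using sums_integral[OF h_int h_summable norm_summable]
    by (simp add: h_suminf set_lebesgue_integral_def)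
  then show "(LINT x:{0..1}|lborel. f x) = 1"
    using sums_single[of 0 "\<lambda>_. 1::complex"] by (metis (no_types, lifting) sums_unique2 sums_cong)
qed

theorem mainTheorem6:
  shows "(\<forall>z::complex. cmod z \<le> 1 \<longrightarrow> summable (\<lambda>k. greedy_coeff k * z ^ k)) \<and>
    (\<forall>t::real. 0 \<le> t \<longrightarrow> t < 1 \<longrightarrow>
      set_integrable lborel {0..1}
        (\<lambda>x::real. greedy_series (of_real (t * x\<^sup>2)) / of_real (1 - t * x)) \<and>
      (LINT x:{0..1}|lborel.
        greedy_series (of_real (t * x\<^sup>2)) / of_real (1 - t * x)) = 1)"
proof (intro conjI allI impI)
  fix z :: complex assume "cmod z \<le> 1"
  then show "summable (\<lambda>k. greedy_coeff k * z ^ k)"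
    by (intro summable_comparison_test'[OF summable_norm_greedy_coeff, of 0])
      (auto simp: norm_mult norm_power intro!: mult_left_le power_le_one)
qed (use greedy_series_integral in auto)

end
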